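(* For every integer $n\ge 1$, $$\sum_{k=0}^{n}(-1)^k\begin{bmatrix} n\\2k\end{bmatrix}q^{2\binom{k}{2}}G_{2n-2k}(q) = [n=1],$$ where $[n=1]$ equals $1$ if $n=1$ and $0$ otherwise.
   Context: Let $q$ be an indeterminate and $\begin{bmatrix} n\\k\end{bmatrix}$ the Gaussian $q$-binomial coefficient (equal to $0$ if $k>n\ge 0$). The $q$-Seidel triangle is the array $(g_{i,k}(q))$, $i\ge1$, determined by $g_{1,1}(q)=g_{2,1}(q)=1$, $g_{i,k}(q)=0$ if $k\le 0$ or $k>\lceil i/2\rceil$, and, for $n\ge 1$, $g_{2n,k}(q)=g_{2n,k+1}(q)+q^{k-1}g_{2n-1,k}(q)$ for $1\le k\le n$ and $g_{2n+1,k}(q)=q^{k-1}g_{2n,k}(q)+g_{2n+1,k-1}(q)$ for $1\le k\le n+1$. The $q$-Genocchi numbers are $G_{2n}(q)=g_{2n-1,n}(q)$ for $n\ge 1$; set $G_0(q)=0$ (this value occurs only with coefficient $0$). *)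

theory Defs
  imports "HOL-Computational_Algebra.Polynomial"
begin

text \<open>Everything lives in \<open>\<int>[q]\<close>; all the objects below are polynomials in \<open>q\<close> with
  integer coefficients.\<close>

abbreviation q :: "int poly" where
  "q \<equiv> [:0, 1:]"

definition q_int :: "nat \<Rightarrow> int poly" where
  "q_int n = (\<Sum>j<n. q ^ j)"

definition q_fact :: "nat \<Rightarrow> int poly" where
  "q_fact n = (\<Prod>i=1..n. q_int i)"

text \<open>The division is exact, see \<open>q_binomial_exact\<close> below.\<close>

definition q_binomial :: "nat \<Rightarrow> nat \<Rightarrow> int poly" where
  "q_binomial n k =
    (if k \<le> n then q_fact n div (q_fact k * q_fact (n - k)) else 0)"

lemma q_fact_0 [simp]: "q_fact 0 = 1"
  by (simp add: q_fact_def)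

lemma q_fact_Suc: "q_fact (Suc n) = q_int (Suc n) * q_fact n"
  by (simp add: q_fact_def mult.commute)

lemma q_int_add: "q_int (m + n) = q_int m + q ^ m * q_int n"
  by (induction n) (simp_all add: q_int_def power_add algebra_simps)

lemma q_int_nonzero: "n > 0 \<Longrightarrow> q_int n \<noteq> 0"
proof -
  assume "n > 0"
  have "poly (q_int n) 1 = int n"
    by (simp add: q_int_def poly_sum)
  with \<open>n > 0\<close> show ?thesis by auto
qed

lemma q_fact_nonzero: "q_fact n \<noteq> 0"
  by (auto simp: q_fact_def q_int_nonzero)

lemma q_fact_dvd: "q_fact a * q_fact b dvd q_fact (a + b)"
proof (induction "a + b" arbitrary: a b rule: less_induct)
  case less
  show ?case
  proof (cases "a = 0 \<or> b = 0")
    case True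
    then show ?thesis by auto
  next
    case False
    then obtain c d where [simp]: "a = Suc c" "b = Suc d"
      by (meson not0_implies_Suc)
    have 1: "q_fact c * q_fact (Suc d) dvd q_fact (Suc (c + d))"
      using less[of c "Suc d"] by simp
    have 2: "q_fact (Suc c) * q_fact d dvd q_fact (Suc (c + d))"
      using less[of "Suc c" d] by simp
    have "q_fact (a + b) = q_int (Suc c + Suc d) * q_fact (Suc (c + d))"
      using q_fact_Suc[of "Suc (c + d)"] by simp
    also have "\<dots> = q_int (Suc c) * q_fact (Suc (c + d))
        + q ^ Suc c * (q_int (Suc d) * q_fact (Suc (c + d)))"
      by (simp only: q_int_add algebra_simps)
    also have "q_fact a * q_fact b dvd \<dots>"
    proof (rule dvd_add)
      show "q_fact a * q_fact b dvd q_int (Suc c) * q_fact (Suc (c + d))"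
        using mult_dvd_mono[OF dvd_refl 1, of "q_int (Suc c)"]
        by (simp add: q_fact_Suc[of c] mult.assoc)
      have "q_fact a * q_fact b = q_int (Suc d) * (q_fact (Suc c) * q_fact d)"
        by (simp add: q_fact_Suc[of d] algebra_simps)
      then show "q_fact a * q_fact b dvd q ^ Suc c * (q_int (Suc d) * q_fact (Suc (c + d)))"
        using mult_dvd_mono[OF dvd_refl 2, of "q_int (Suc d)"]
        by (metis dvd_mult)
    qed
    finally show ?thesis .
  qed
qed

lemma q_binomial_exact:
  "k \<le> n \<Longrightarrow> q_binomial n k * (q_fact k * q_fact (n - k)) = q_fact n"
  using q_fact_dvd[of k "n - k"] by (simp add: q_binomial_def)

text \<open>The \<open>q\<close>-Seidel triangle, whose rows have index \<open>i \<ge> 1\<close>; row \<open>0\<close> is a dummy, and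
  \<open>(i + 1) div 2 = \<lceil>i/2\<rceil>\<close>. Even rows are filled from right to left, odd rows from left to right.
  The defining relations are recovered below.\<close>

function q_seidel :: "nat \<Rightarrow> nat \<Rightarrow> int poly" where
  "q_seidel i k =
    (if i = 0 \<or> k = 0 \<or> k > (i + 1) div 2 then 0
     else if i = 1 then 1
     else if even i then q_seidel i (k + 1) + q ^ (k - 1) * q_seidel (i - 1) k
     else q ^ (k - 1) * q_seidel (i - 1) k + q_seidel i (k - 1))"
  by pat_completeness auto
termination
  by (relation "measures [\<lambda>(i, k). i, \<lambda>(i, k). if even i then i + 1 - k else k]") auto

declare q_seidel.simps [simp del]

lemma q_seidel_outside: "k = 0 \<or> k > (i + 1) div 2 \<Longrightarrow> q_seidel i k = 0"
  by (subst q_seidel.simps) auto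

lemma q_seidel_1_1: "q_seidel 1 1 = 1"
  by (subst q_seidel.simps) simp

lemma q_seidel_even:
  "1 \<le> k \<Longrightarrow> k \<le> n \<Longrightarrow>
    q_seidel (2 * n) k = q_seidel (2 * n) (k + 1) + q ^ (k - 1) * q_seidel (2 * n - 1) k"
  by (subst q_seidel.simps) auto

lemma q_seidel_odd:
  "1 \<le> n \<Longrightarrow> 1 \<le> k \<Longrightarrow> k \<le> n + 1 \<Longrightarrow>
    q_seidel (2 * n + 1) k = q ^ (k - 1) * q_seidel (2 * n) k + q_seidel (2 * n + 1) (k - 1)"
  by (subst q_seidel.simps) auto

lemma q_seidel_2_1: "q_seidel 2 1 = 1"
  using q_seidel_even[of 1 1] q_seidel_1_1 by (simp add: q_seidel_outside)

text \<open>\<open>q_genocchi m\<close> is \<open>G\<^sub>m(q)\<close>; only even \<open>m\<close> are meaningful, and odd indices get a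
  dummy value.\<close>

definition q_genocchi :: "nat \<Rightarrow> int poly" where
  "q_genocchi m = (if m = 0 \<or> odd m then 0 else q_seidel (m - 1) (m div 2))"

lemma q_genocchi_even: "n \<ge> 1 \<Longrightarrow> q_genocchi (2 * n) = q_seidel (2 * n - 1) n"
  by (simp add: q_genocchi_def)

end

theory Submission imports Defs begin

text \<open>The rows of the triangle are linked by the \<open>q\<close>-difference operator
  \<open>D f(m) = q\<^sup>-\<^sup>m (f(m + 1) - f(m))\<close>: writing \<open>f\<^sub>n(m) = g\<^bsub>2n-1,m\<^esub>\<close>, one has
  \<open>D f\<^sub>n(m) = g\<^bsub>2n-2,m+1\<^esub>\<close> and \<open>D\<^sup>2 f\<^sub>n = - E f\<^bsub>n-1\<^esub>\<close>, where \<open>E\<close> is the shift. Since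
  \<open>D E = q E D\<close>, iteration gives \<open>D\<^sup>2\<^sup>k f\<^sub>n = (-1)\<^sup>k q\<^bsup>k(k-1)\<^esup> E\<^sup>k f\<^bsub>n-k\<^esub>\<close>. The backward Newton
  formula \<open>f\<^sub>n(0) = \<Sum>\<^sub>j (-1)\<^sup>j [n,j] D\<^sup>j f\<^sub>n(n - j)\<close> then is the claim: the left side is
  \<open>g\<^bsub>2n-1,0\<^esub> = 0\<close>, and for \<open>n \<ge> 2\<close> the odd terms vanish because they are entries just outside
  the triangle.\<close>

lemma q_binomial_0 [simp]: "q_binomial n 0 = 1"
  by (simp add: q_binomial_def q_fact_nonzero)

lemma q_binomial_eq_0: "n < k \<Longrightarrow> q_binomial n k = 0"
  by (simp add: q_binomial_def)

lemma q_binomial_self [simp]: "q_binomial n n = 1"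
  by (simp add: q_binomial_def q_fact_nonzero)

text \<open>For \<open>k < n\<close>, clear denominators and split \<open>q_int (Suc n)\<close>
  along \<open>Suc n = (n - k) + Suc k\<close>.\<close>

lemma q_binomial_Suc_Suc:
  "q_binomial (Suc n) (Suc k) = q_binomial n (Suc k) + q ^ (n - k) * q_binomial n k"
proof (cases "k < n")
  case True
  then obtain d where n: "n = Suc (k + d)"
    using less_iff_Suc_add by auto
  have 1: "q_binomial (Suc n) (Suc k) * (q_fact (Suc k) * q_fact (Suc d)) = q_fact (Suc n)"
    using q_binomial_exact[of "Suc k" "Suc n"] by (simp add: n Suc_diff_le)
  have 2: "q_binomial n (Suc k) * (q_fact (Suc k) * q_fact d) = q_fact n"
    using q_binomial_exact[of "Suc k" n] by (simp add: n)
  have 3: "q_binomial n k * (q_fact k * q_fact (Suc d)) = q_fact n"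
    using q_binomial_exact[of k n] by (simp add: n Suc_diff_le)
  have "q_binomial (Suc n) (Suc k) * (q_fact (Suc k) * q_fact (Suc d))
      = q_int (Suc d + Suc k) * q_fact n"
    by (simp only: 1 q_fact_Suc[of n]) (simp add: n add.commute)
  also have "\<dots> = q_int (Suc d) * q_fact n + q ^ Suc d * (q_int (Suc k) * q_fact n)"
    by (simp only: q_int_add algebra_simps)
  also have "\<dots> = q_int (Suc d) * (q_binomial n (Suc k) * (q_fact (Suc k) * q_fact d))
      + q ^ Suc d * (q_int (Suc k) * (q_binomial n k * (q_fact k * q_fact (Suc d))))"
    by (simp only: 2 3)
  also have "\<dots> = (q_binomial n (Suc k) + q ^ Suc d * q_binomial n k)
      * (q_fact (Suc k) * q_fact (Suc d))"
    by (simp only: q_fact_Suc algebra_simps)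
  finally show ?thesis
    by (simp add: q_fact_nonzero n Suc_diff_le del: power_Suc)
next
  case False
  then consider "k = n" | "n < k" by linarith
  then show ?thesis
    by cases (simp_all add: q_binomial_eq_0)
qed

text \<open>Here \<open>a j m\<close> plays the role of \<open>D\<^sup>j f(m)\<close>; stating the recurrence without division keeps
  everything inside \<open>\<int>[q]\<close>.\<close>

lemma q_newton_backward:
  fixes a :: "nat \<Rightarrow> nat \<Rightarrow> int poly"
  assumes "\<And>j m. j + m < n \<Longrightarrow> a j (Suc m) = a j m + q ^ m * a (Suc j) m"
  shows "a 0 0 = (\<Sum>j\<le>n. (-1) ^ j * q_binomial n j * a j (n - j))"
  using assms
proof (induction n)
  case 0
  then show ?case by simp
next
  case (Suc n)
  have step: "(-1) ^ j * q_binomial n j * a j (n - j) =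
      (-1) ^ j * q_binomial n j * a j (Suc n - j)
      + (-1) ^ Suc j * (q ^ (n - j) * q_binomial n j) * a (Suc j) (n - j)" if "j \<le> n" for j
    using Suc.prems[of j "n - j"] that by (simp add: Suc_diff_le algebra_simps)
  have "a 0 0 = (\<Sum>j\<le>n. (-1) ^ j * q_binomial n j * a j (n - j))"
    using Suc by simp
  also have "\<dots> = (\<Sum>j\<le>n. (-1) ^ j * q_binomial n j * a j (Suc n - j))
      + (\<Sum>j\<le>n. (-1) ^ Suc j * (q ^ (n - j) * q_binomial n j) * a (Suc j) (n - j))"
    unfolding sum.distrib[symmetric] by (intro sum.cong refl step) simp
  \<comment> \<open>The extra term is zero; an index shift then aligns this sum with the other for
    the Pascal rule.\<close>
  also have "(\<Sum>j\<le>n. (-1) ^ j * q_binomial n j * a j (Suc n - j))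
      = (\<Sum>j\<le>Suc n. (-1) ^ j * q_binomial n j * a j (Suc n - j))"
    by (simp add: q_binomial_eq_0)
  also have "\<dots> = a 0 (Suc n)
      + (\<Sum>j\<le>n. (-1) ^ Suc j * q_binomial n (Suc j) * a (Suc j) (n - j))"
    by (subst sum.atMost_Suc_shift) simp
  finally have "a 0 0 = a 0 (Suc n)
      + (\<Sum>j\<le>n. (-1) ^ Suc j * q_binomial (Suc n) (Suc j) * a (Suc j) (n - j))"
    by (simp only: q_binomial_Suc_Suc sum.distrib distrib_left distrib_right add.assoc)
  also have "\<dots> = (\<Sum>j\<le>Suc n. (-1) ^ j * q_binomial (Suc n) j * a j (Suc n - j))"
    by (subst sum.atMost_Suc_shift) simp
  finally show ?case .
qed

text \<open>\<open>seidel_diff n j m\<close> is \<open>D\<^sup>j f\<^sub>n(m)\<close> in the region \<open>j + m \<le> n\<close>.\<close>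

definition seidel_diff :: "nat \<Rightarrow> nat \<Rightarrow> nat \<Rightarrow> int poly" where
  "seidel_diff n j m = (let k = j div 2 in
    if even j then (-1) ^ k * q ^ (k * (k - 1)) * q_seidel (2 * (n - k) - 1) (m + k)
    else (-1) ^ k * q ^ (k * k) * q_seidel (2 * (n - k - 1)) (m + k + 1))"

text \<open>Even \<open>j\<close> uses the odd-row recurrence, odd \<open>j\<close> the even-row
  one; the column shift by \<open>k\<close> leaves a spare \<open>q ^ k\<close>, absorbed into the
  prefactor.\<close>

lemma seidel_diff_Suc:
  assumes "n \<ge> 2" "j + m < n"
  shows "seidel_diff n j (Suc m) = seidel_diff n j m + q ^ m * seidel_diff n (Suc j) m"
proof (cases "even j")
  case True
  then obtain k where j: "j = 2 * k" by blast
  define N where "N = n - k - 1"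
  \<comment> \<open>\<open>N \<ge> 1\<close> rests on \<open>n \<ge> 2\<close>: row 1 is a seed
    outside the odd-row recurrence.\<close>
  have N: "N \<ge> 1" "m + k + 1 \<le> N + 1" "2 * (n - k) - 1 = 2 * N + 1"
    using assms by (auto simp: N_def j)
  have "q_seidel (2 * N + 1) (m + k + 1)
      = q ^ (m + k) * q_seidel (2 * N) (m + k + 1) + q_seidel (2 * N + 1) (m + k)"
    using q_seidel_odd[of N "m + k + 1"] N by simp
  moreover have "q ^ (k * k) = q ^ (k * (k - 1)) * q ^ k"
    by (cases k) (simp_all add: power_add)
  moreover have "seidel_diff n j l =
      (-1) ^ k * q ^ (k * (k - 1)) * q_seidel (2 * N + 1) (l + k)" for l
    by (simp only: seidel_diff_def Let_def j N(3)[symmetric]) simp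
  moreover have "seidel_diff n (Suc j) m =
      (-1) ^ k * q ^ (k * k) * q_seidel (2 * N) (m + k + 1)"
    by (simp add: seidel_diff_def j N_def)
  ultimately show ?thesis
    by (simp add: power_add distrib_left ac_simps)
next
  case False
  then obtain k where j: "j = 2 * k + 1" using oddE by blast
  define N where "N = n - k - 1"
  have N: "m + k + 1 \<le> N" "n - Suc k = N"
    using assms by (auto simp: N_def j)
  have "q_seidel (2 * N) (m + k + 1)
      = q_seidel (2 * N) (m + k + 2) + q ^ (m + k) * q_seidel (2 * N - 1) (m + k + 1)"
    using q_seidel_even[of "m + k + 1" N] N by simp
  moreover have "seidel_diff n j l =
      (-1) ^ k * q ^ (k * k) * q_seidel (2 * N) (l + k + 1)" for l
    by (simp add: seidel_diff_def j N_def)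
  moreover have "seidel_diff n (Suc j) m =
      - ((-1) ^ k * (q ^ (k * k) * q ^ k) * q_seidel (2 * N - 1) (m + k + 1))"
    using N(2) by (simp add: seidel_diff_def j power_add ac_simps)
  ultimately show ?thesis
    by (simp add: power_add distrib_left ac_simps)
qed

lemma seidel_diff_0_0: "seidel_diff n 0 0 = 0"
  by (simp add: seidel_diff_def q_seidel_outside)

text \<open>With \<open>k = j div 2\<close>, column \<open>n - k\<close> is one past the end of row
  \<open>2 * (n - k - 1)\<close>.\<close>

lemma seidel_diff_odd_boundary:
  "odd j \<Longrightarrow> j \<le> n \<Longrightarrow> seidel_diff n j (n - j) = 0"
  by (auto simp: seidel_diff_def elim!: oddE intro!: q_seidel_outside)

lemma seidel_diff_even_boundary:
  assumes "n \<ge> 1" "2 * k \<le> n"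
  shows "seidel_diff n (2 * k) (n - 2 * k) =
    (-1) ^ k * q ^ (2 * (k choose 2)) * q_genocchi (2 * n - 2 * k)"
proof -
  have "2 * (k choose 2) = k * (k - 1)"
    by (auto simp add: choose_two intro!: dvd_mult_div_cancel)
  moreover have "q_genocchi (2 * n - 2 * k) = q_seidel (2 * (n - k) - 1) (n - k)"
    using q_genocchi_even[of "n - k"] assms by (simp add: diff_mult_distrib2)
  moreover have "n - 2 * k + k = n - k"
    using assms by simp
  ultimately show ?thesis
    by (simp add: seidel_diff_def)
qed

theorem theorem4p1:
  fixes n :: nat
  assumes "n \<ge> 1"
  shows "(\<Sum>k=0..n. (-1) ^ k * q_binomial n (2 * k) * q ^ (2 * (k choose 2)) *
      q_genocchi (2 * n - 2 * k)) = (if n = 1 then 1 else 0)"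
proof (cases "n = 1")
  case True
  then show ?thesis
    using q_genocchi_even[of 1] q_seidel_1_1 by (simp add: q_binomial_eq_0 choose_two)
next
  case False
  with assms have n: "n \<ge> 2" by simp
  let ?t = "\<lambda>j. (-1) ^ j * q_binomial n j * seidel_diff n j (n - j)"
  have "(\<Sum>k=0..n. (-1) ^ k * q_binomial n (2 * k) * q ^ (2 * (k choose 2)) *
      q_genocchi (2 * n - 2 * k)) = (\<Sum>k=0..n. ?t (2 * k))"
  proof (intro sum.cong refl)
    fix k
    show "(-1) ^ k * q_binomial n (2 * k) * q ^ (2 * (k choose 2)) * q_genocchi (2 * n - 2 * k)
        = ?t (2 * k)"
      using seidel_diff_even_boundary[OF assms, of k]
      by (cases "2 * k \<le> n") (simp_all add: q_binomial_eq_0 ac_simps)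
  qed
  also have "\<dots> = sum ?t ((*) 2 ` {0..n})"
    by (subst sum.reindex) (auto simp: inj_on_def)
  also have "\<dots> = sum ?t {..n}"
  \<comment> \<open>Even \<open>j > n\<close> drop out through the binomial, odd
    \<open>j \<le> n\<close> through the boundary zeros.\<close>
  proof (rule sum.mono_neutral_cong)
    show "?t j = 0" if "j \<in> (*) 2 ` {0..n} - {..n}" for j
      using that by (simp add: q_binomial_eq_0)
    show "?t j = 0" if "j \<in> {..n} - (*) 2 ` {0..n}" for j
    proof -
      have "odd j"
        using that by (force elim!: evenE)
      then show ?thesis
        using that by (simp add: seidel_diff_odd_boundary)
    qed
  qed auto
  also have "\<dots> = seidel_diff n 0 0"
    by (rule q_newton_backward[symmetric]) (rule seidel_diff_Suc[OF n])
  finally show ?thesis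
    using False by (simp add: seidel_diff_0_0)
qed

end
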